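(* Let $\hat g,\hat f_1,\hat f_2\in\mathbb{R}[[t]]$ with $\hat g(0)\ne0$ and $\hat f_1,\hat f_2$ of order $1$, and let $(\hat g;\hat f_1,\hat f_2)$ be the corresponding compressed double Riordan array. If $\hat g$, $\hat f_1$ and $\hat f_2$ are Pólya frequency formal power series, then $(\hat g;\hat f_1,\hat f_2)$ is totally positive.
   Context: The compressed double Riordan array $(\hat g;\hat f_1,\hat f_2)$ is the infinite lower triangular matrix whose $k$-th column has generating function $\hat g(\hat f_1\hat f_2)^{\ell}$ for $k=2\ell$ and $\hat g\hat f_1(\hat f_1\hat f_2)^{\ell}$ for $k=2\ell+1$, i.e. columns $(\hat g,\hat g\hat f_1,\hat g\hat f_1\hat f_2,\hat g\hat f_1^2\hat f_2,\ldots)$. A matrix is totally positive (TP) if all its minors are nonnegative. A nonnegative sequence $(a_n)_{n\ge0}$ is a Pólya frequency (PF) sequence if its Toeplitz matrix $[a_{i-j}]_{i,j\ge0}$ ($a_m=0$ for $m<0$) is TP; a power series is a Pólya frequency formal power series if its coefficient sequence is PF (equivalently, it equals $Ct^ke^{\gamma t}\prod_j(1+\alpha_jt)/\prod_j(1-\beta_jt)$ with $C>0$, $k\in\mathbb{N}$, $\alpha_j,\beta_j,\gamma\ge0$, $\sum_j(\alpha_j+\beta_j)<\infty$). *)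

theory Defs
  imports "HOL-Computational_Algebra.Formal_Power_Series" "Jordan_Normal_Form.Determinant"
begin

text \<open>Infinite real matrices are functions \<open>nat \<Rightarrow> nat \<Rightarrow> real\<close> (row index first, both from 0).
  In \<open>minor A n r c\<close>, only the values of \<open>r\<close> and \<open>c\<close> below \<open>n\<close> matter.\<close>

definition minor :: "(nat \<Rightarrow> nat \<Rightarrow> real) \<Rightarrow> nat \<Rightarrow> (nat \<Rightarrow> nat) \<Rightarrow> (nat \<Rightarrow> nat) \<Rightarrow> real" where
  "minor A n r c = det (mat n n (\<lambda>(i, j). A (r i) (c j)))"

definition totally_positive :: "(nat \<Rightarrow> nat \<Rightarrow> real) \<Rightarrow> bool" where
  "totally_positive A \<longleftrightarrow>
     (\<forall>n r c. strict_mono_on {..<n} r \<longrightarrow> strict_mono_on {..<n} c \<longrightarrow> 0 \<le> minor A n r c)"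

definition toeplitz :: "(nat \<Rightarrow> real) \<Rightarrow> nat \<Rightarrow> nat \<Rightarrow> real" where
  "toeplitz a i j = (if j \<le> i then a (i - j) else 0)"

definition PF_sequence :: "(nat \<Rightarrow> real) \<Rightarrow> bool" where
  "PF_sequence a \<longleftrightarrow> (\<forall>n. 0 \<le> a n) \<and> totally_positive (toeplitz a)"

definition PF_fps :: "real fps \<Rightarrow> bool" where
  "PF_fps f \<longleftrightarrow> PF_sequence (fps_nth f)"

definition riordan_column :: "real fps \<Rightarrow> real fps \<Rightarrow> real fps \<Rightarrow> nat \<Rightarrow> real fps" where
  "riordan_column g f1 f2 k =
     (if even k then g * (f1 * f2) ^ (k div 2) else g * f1 * (f1 * f2) ^ (k div 2))"

definition compressed_double_riordan ::
    "real fps \<Rightarrow> real fps \<Rightarrow> real fps \<Rightarrow> nat \<Rightarrow> nat \<Rightarrow> real" where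
  "compressed_double_riordan g f1 f2 n k = fps_nth (riordan_column g f1 f2 k) n"

end

theory Submission
  imports Defs
begin

text \<open>
  Write \<open>f\<^sub>1 = t h\<close>. Removing the common factors from the columns gives
  \<open>(g; f\<^sub>1, f\<^sub>2) = T(g) (1 \<oplus> (h; f\<^sub>2, f\<^sub>1))\<close>, where \<open>T(g)\<close> is the Toeplitz matrix of \<open>g\<close> and
  \<open>h\<close> is again a PF series, since \<open>T(h)\<close> is \<open>T(f\<^sub>1)\<close> without its first row. As \<open>T(g)\<close> is lower
  triangular, Cauchy--Binet reduces the minors using rows below \<open>N + 1\<close> to those of the smaller
  array using rows below \<open>N\<close>.
\<close>

section \<open>The Cauchy--Binet formula\<close>

lemma det_permute_columns_mat:
  fixes A :: "nat \<Rightarrow> nat \<Rightarrow> 'a :: comm_ring_1"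
  assumes p: "p permutes {0..<n}"
  shows "det (mat n n (\<lambda>(i, j). A i (f (p j)))) = signof p * det (mat n n (\<lambda>(i, j). A i (f j)))"
proof -
  have "det (mat n n (\<lambda>(i, j). A i (f (p j)))) = det (mat n n (\<lambda>(i, j). A i (f (p j))))\<^sup>T"
    by (subst det_transpose) auto
  also have "(mat n n (\<lambda>(i, j). A i (f (p j))))\<^sup>T
      = mat n n (\<lambda>(i, j). (mat n n (\<lambda>(i, j). A i (f j)))\<^sup>T $$ (p i, j))"
    using p by (intro eq_matI) (auto simp: permutes_nat_less)
  also have "det \<dots> = signof p * det ((mat n n (\<lambda>(i, j). A i (f j)))\<^sup>T)"
    by (rule det_permute_rows) (use p in auto)
  also have "det ((mat n n (\<lambda>(i, j). A i (f j)))\<^sup>T) = det (mat n n (\<lambda>(i, j). A i (f j)))"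
    by (rule det_transpose) auto
  finally show ?thesis .
qed

lemma det_permute_rows_mat:
  fixes B :: "nat \<Rightarrow> nat \<Rightarrow> 'a :: comm_ring_1"
  assumes p: "p permutes {0..<n}"
  shows "det (mat n n (\<lambda>(i, j). B (f (p i)) j)) = signof p * det (mat n n (\<lambda>(i, j). B (f i) j))"
proof -
  have "mat n n (\<lambda>(i, j). B (f (p i)) j)
      = mat n n (\<lambda>(i, j). (mat n n (\<lambda>(i, j). B (f i) j)) $$ (p i, j))"
    using p by (intro eq_matI) (auto simp: permutes_nat_less)
  also have "det \<dots> = signof p * det (mat n n (\<lambda>(i, j). B (f i) j))"
    by (rule det_permute_rows) (use p in auto)
  finally show ?thesis .
qed

text \<open>Multilinearity in the columns: column \<open>j\<close> of the product combines columns
  of \<open>A\<close> with coefficients \<open>B k j\<close>, and \<open>f\<close> records which one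
  is chosen for each \<open>j\<close>. Extensional maps make the set of choices finite.\<close>

lemma det_mat_sum_expand:
  fixes A B :: "nat \<Rightarrow> nat \<Rightarrow> 'a :: comm_ring_1"
  shows "det (mat n n (\<lambda>(i, j). \<Sum>k<N. A i k * B k j))
    = (\<Sum>f \<in> {..<n} \<rightarrow>\<^sub>E {..<N}. (\<Prod>j<n. B (f j) j) * det (mat n n (\<lambda>(i, j). A i (f j))))"
proof -
  let ?P = "{p. p permutes {0..<n}}"
  let ?F = "{..<n} \<rightarrow>\<^sub>E {..<N}"
  have "det (mat n n (\<lambda>(i, j). \<Sum>k<N. A i k * B k j))
      = (\<Sum>p\<in>?P. signof p * (\<Prod>j<n. \<Sum>k<N. A (p j) k * B k j))"
    by (subst det_col[where n = n]) (auto intro!: sum.cong prod.cong simp: permutes_nat_less)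
  also have "\<dots> = (\<Sum>p\<in>?P. \<Sum>f\<in>?F. signof p * (\<Prod>j<n. A (p j) (f j) * B (f j) j))"
    by (simp add: prod_sum_PiE sum_distrib_left)
  also have "\<dots> = (\<Sum>f\<in>?F. \<Sum>p\<in>?P. signof p * (\<Prod>j<n. A (p j) (f j) * B (f j) j))"
    by (rule sum.swap)
  also have "\<dots> = (\<Sum>f\<in>?F. (\<Prod>j<n. B (f j) j) * det (mat n n (\<lambda>(i, j). A i (f j))))"
  proof (rule sum.cong[OF refl])
    fix f
    have "det (mat n n (\<lambda>(i, j). A i (f j))) = (\<Sum>p\<in>?P. signof p * (\<Prod>j<n. A (p j) (f j)))"
      by (subst det_col[where n = n]) (auto intro!: sum.cong prod.cong simp: permutes_nat_less)
    then show "(\<Sum>p\<in>?P. signof p * (\<Prod>j<n. A (p j) (f j) * B (f j) j))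
        = (\<Prod>j<n. B (f j) j) * det (mat n n (\<lambda>(i, j). A i (f j)))"
      by (simp add: prod.distrib sum_distrib_left mult_ac)
  qed
  finally show ?thesis .
qed

text \<open>Serves to reindex the sum over choice maps. Since \<open>p\<close> fixes every point
  outside \<open>S\<close>, composing with it preserves the default value there.\<close>

lemma bij_betw_PiE_compose_permutes:
  assumes "p permutes S"
  shows "bij_betw (\<lambda>f. f \<circ> p) (S \<rightarrow>\<^sub>E T) (S \<rightarrow>\<^sub>E T)"
proof (rule bij_betwI[where g = "\<lambda>f. f \<circ> Hilbert_Choice.inv p"])
  have *: "f \<circ> q \<in> S \<rightarrow>\<^sub>E T" if "q permutes S" "f \<in> S \<rightarrow>\<^sub>E T" for f q
    using that permutes_in_image[OF that(1)] by (auto simp: PiE_iff extensional_def)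
  show "(\<lambda>f. f \<circ> p) \<in> (S \<rightarrow>\<^sub>E T) \<rightarrow> (S \<rightarrow>\<^sub>E T)" "(\<lambda>f. f \<circ> Hilbert_Choice.inv p) \<in> (S \<rightarrow>\<^sub>E T) \<rightarrow> (S \<rightarrow>\<^sub>E T)"
    using * assms permutes_inv[OF assms] by blast+
qed (simp_all add: comp_assoc permutes_inv_o[OF assms])

text \<open>
  Cauchy--Binet, symmetrised: summing over all maps instead of over increasing ones counts every
  \<open>n\<close>-subset \<open>n!\<close> times, and avoids splitting an injection into a subset and a permutation.
\<close>

lemma cauchy_binet_symmetrised:
  fixes A B :: "nat \<Rightarrow> nat \<Rightarrow> 'a :: comm_ring_1"
  shows "of_nat (fact n) * det (mat n n (\<lambda>(i, j). \<Sum>k<N. A i k * B k j))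
    = (\<Sum>f \<in> {..<n} \<rightarrow>\<^sub>E {..<N}.
         det (mat n n (\<lambda>(i, j). A i (f j))) * det (mat n n (\<lambda>(i, j). B (f i) j)))"
proof -
  let ?P = "{p. p permutes {0..<n}}"
  let ?F = "{..<n} \<rightarrow>\<^sub>E {..<N}"
  let ?D = "det (mat n n (\<lambda>(i, j). \<Sum>k<N. A i k * B k j))"
  let ?A = "\<lambda>f. det (mat n n (\<lambda>(i, j). A i (f j)))"
  \<comment> \<open>Every \<open>p\<close> yields an expansion of the same determinant, the sign
    coming from the permuted columns of \<open>A\<close>. Adding these over all \<open>n!\<close>
    permutations assembles, for each \<open>f\<close>, the Leibniz expansion of the minor of
    \<open>B\<close>.\<close>
  have "?D = (\<Sum>f\<in>?F. signof p * (\<Prod>j<n. B (f (p j)) j) * ?A f)" if p: "p \<in> ?P" for p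
  proof -
    have "bij_betw (\<lambda>f. f \<circ> p) ?F ?F"
      using p by (intro bij_betw_PiE_compose_permutes) (simp add: atLeast0LessThan)
    then have "?D = (\<Sum>f\<in>?F. (\<Prod>j<n. B ((f \<circ> p) j) j) * ?A (f \<circ> p))"
      unfolding det_mat_sum_expand by (rule sum.reindex_bij_betw[symmetric])
    also have "\<dots> = (\<Sum>f\<in>?F. signof p * (\<Prod>j<n. B (f (p j)) j) * ?A f)"
      using p by (simp add: det_permute_columns_mat mult_ac)
    finally show ?thesis .
  qed
  then have "(\<Sum>p\<in>?P. ?D) = (\<Sum>p\<in>?P. \<Sum>f\<in>?F. signof p * (\<Prod>j<n. B (f (p j)) j) * ?A f)"
    by (rule sum.cong[OF refl])
  also have "\<dots> = (\<Sum>f\<in>?F. \<Sum>p\<in>?P. signof p * (\<Prod>j<n. B (f (p j)) j) * ?A f)"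
    by (rule sum.swap)
  also have "\<dots> = (\<Sum>f\<in>?F. ?A f * det (mat n n (\<lambda>(i, j). B (f i) j)))"
  proof (rule sum.cong[OF refl])
    fix f
    have "det (mat n n (\<lambda>(i, j). B (f i) j)) = (\<Sum>p\<in>?P. signof p * (\<Prod>j<n. B (f (p j)) j))"
      by (subst det_col[where n = n]) (auto intro!: sum.cong prod.cong simp: permutes_nat_less)
    then show "(\<Sum>p\<in>?P. signof p * (\<Prod>j<n. B (f (p j)) j) * ?A f)
        = ?A f * det (mat n n (\<lambda>(i, j). B (f i) j))"
      by (simp add: sum_distrib_left mult_ac)
  qed
  finally show ?thesis
    by (simp add: card_permutations[OF refl])
qed

section \<open>Nonnegative minors of a matrix product\<close>

text \<open>The sorting permutation takes \<open>i\<close> to the position at which \<open>f\<close>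
  attains its \<open>i\<close>-th smallest value.\<close>

lemma strict_mono_on_permute:
  fixes f :: "nat \<Rightarrow> nat"
  assumes inj: "inj_on f {..<n}"
  obtains p where "p permutes {0..<n}" "strict_mono_on {..<n} (f \<circ> p)"
proof -
  let ?S = "f ` {..<n}"
  have card: "card ?S = n"
    using inj by (simp add: card_image)
  obtain h where h: "bij_betw h {..<n} ?S" "strict_mono_on {..<n} h"
    using ex_bij_betw_strict_mono_card[of ?S] unfolding card by blast
  \<comment> \<open>The identity from \<open>n\<close> on, as \<open>permutes\<close>
    demands.\<close>
  define p where "p i = (if i < n then inv_into {..<n} f (h i) else i)" for i
  have "bij_betw (inv_into {..<n} f \<circ> h) {..<n} {..<n}"
    using h(1) inj by (intro bij_betw_trans[OF h(1)] bij_betw_inv_into) (simp add: bij_betw_def)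
  then have "bij_betw p {..<n} {..<n}"
    by (rule bij_betw_cong[THEN iffD1, rotated]) (simp add: p_def)
  then have "p permutes {..<n}"
    by (rule bij_imp_permutes) (simp add: p_def)
  moreover have "(f \<circ> p) i = h i" if "i < n" for i
    using that bij_betwE[OF h(1)] by (simp add: p_def f_inv_into_f)
  then have "strict_mono_on {..<n} (f \<circ> p)"
    using h(2) by (simp add: strict_mono_on_def)
  ultimately show ?thesis
    using that by (simp add: atLeast0LessThan)
qed

text \<open>Each term is unchanged when \<open>f\<close> is sorted, because the two signs cancel.\<close>

lemma det_mult_det_nonneg:
  fixes A B :: "nat \<Rightarrow> nat \<Rightarrow> real"
  assumes f: "f \<in> {..<n} \<rightarrow> {..<N}"
    and A: "\<And>s. strict_mono_on {..<n} s \<Longrightarrow> 0 \<le> det (mat n n (\<lambda>(i, j). A i (s j)))"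
    and B: "\<And>s. strict_mono_on {..<n} s \<Longrightarrow> s \<in> {..<n} \<rightarrow> {..<N}
      \<Longrightarrow> 0 \<le> det (mat n n (\<lambda>(i, j). B (s i) j))"
  shows "0 \<le> det (mat n n (\<lambda>(i, j). A i (f j))) * det (mat n n (\<lambda>(i, j). B (f i) j))"
proof (cases "inj_on f {..<n}")
  case True
  then obtain p where p: "p permutes {0..<n}" "strict_mono_on {..<n} (f \<circ> p)"
    by (rule strict_mono_on_permute)
  have "f \<circ> p \<in> {..<n} \<rightarrow> {..<N}"
    using f p(1) by (auto simp: permutes_nat_less)
  then have "0 \<le> det (mat n n (\<lambda>(i, j). A i ((f \<circ> p) j))) * det (mat n n (\<lambda>(i, j). B ((f \<circ> p) i) j))"
    using p(2) by (intro mult_nonneg_nonneg A B)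
  also have "\<dots> = (signof p * signof p)
      * (det (mat n n (\<lambda>(i, j). A i (f j))) * det (mat n n (\<lambda>(i, j). B (f i) j)))"
    using p(1) by (simp add: det_permute_columns_mat det_permute_rows_mat)
  also have "(signof p * signof p :: real) = 1"
    by (simp add: sign_def)
  finally show ?thesis
    by simp
next
  case False
  then obtain i j where ij: "i < n" "j < n" "i \<noteq> j" "f i = f j"
    by (auto simp: inj_on_def)
  have "det (mat n n (\<lambda>(i, j). B (f i) j)) = 0"
    by (rule det_identical_rows[of _ n i j]) (use ij in \<open>auto intro!: eq_vecI\<close>)
  then show ?thesis
    by simp
qed

text \<open>Each Cauchy--Binet term pairs a minor of \<open>A\<close> with one of \<open>B\<close>.
  The second factor only has rows below \<open>N\<close>, and this bound is what lets an induction
  on the number of rows supply \<open>B\<close>.\<close>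

lemma minor_product_nonneg:
  assumes C: "\<And>i j. i < n \<Longrightarrow> j < n \<Longrightarrow> C (r i) (c j) = (\<Sum>k<N. A (r i) k * B k (c j))"
    and A: "\<And>s. strict_mono_on {..<n} s \<Longrightarrow> 0 \<le> minor A n r s"
    and B: "\<And>s. strict_mono_on {..<n} s \<Longrightarrow> s \<in> {..<n} \<rightarrow> {..<N} \<Longrightarrow> 0 \<le> minor B n s c"
  shows "0 \<le> minor C n r c"
proof -
  have "minor C n r c = det (mat n n (\<lambda>(i, j). \<Sum>k<N. A (r i) k * B k (c j)))"
    unfolding minor_def by (intro arg_cong[where f = det] eq_matI) (auto simp: C)
  then have "of_nat (fact n) * minor C n r c = (\<Sum>f \<in> {..<n} \<rightarrow>\<^sub>E {..<N}.
      det (mat n n (\<lambda>(i, j). A (r i) (f j))) * det (mat n n (\<lambda>(i, j). B (f i) (c j))))"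
    using cauchy_binet_symmetrised[where A = "\<lambda>i k. A (r i) k" and B = "\<lambda>k j. B k (c j)"] by simp
  also have "\<dots> \<ge> 0"
  proof (rule sum_nonneg)
    fix f assume "f \<in> {..<n} \<rightarrow>\<^sub>E {..<N}"
    then have "f \<in> {..<n} \<rightarrow> {..<N}"
      by (auto simp: PiE_def)
    then show "0 \<le> det (mat n n (\<lambda>(i, j). A (r i) (f j))) * det (mat n n (\<lambda>(i, j). B (f i) (c j)))"
      by (rule det_mult_det_nonneg[where A = "\<lambda>i k. A (r i) k" and B = "\<lambda>k j. B k (c j)"])
        (use A B in \<open>simp_all add: minor_def\<close>)
  qed
  finally show ?thesis
    using fact_gt_zero[of n, where 'a = real] by (simp add: zero_le_mult_iff)
qed

section \<open>Minors of the block sum \<open>1 \<oplus> A\<close>\<close>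

definition one_block_sum :: "(nat \<Rightarrow> nat \<Rightarrow> real) \<Rightarrow> nat \<Rightarrow> nat \<Rightarrow> real" where
  "one_block_sum A i j =
     (if i = 0 \<and> j = 0 then 1 else if i = 0 \<or> j = 0 then 0 else A (i - 1) (j - 1))"

lemma minor_one_block_sum_Suc:
  "minor (one_block_sum A) n (\<lambda>i. Suc (r i)) (\<lambda>j. Suc (c j)) = minor A n r c"
  by (simp add: minor_def one_block_sum_def)

lemma minor_cong:
  assumes "\<And>i. i < n \<Longrightarrow> r i = r' i" "\<And>j. j < n \<Longrightarrow> c j = c' j"
  shows "minor A n r c = minor A n r' c'"
  unfolding minor_def by (intro arg_cong[where f = det] eq_matI) (auto simp: assms)

text \<open>Laplace expansion along the first row, where at most the corner entry survives. It
  covers both a corner entry 1 and a row that vanishes entirely.\<close>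

lemma minor_Suc_first_row:
  assumes "\<And>j. 0 < j \<Longrightarrow> j \<le> n \<Longrightarrow> A (r 0) (c j) = 0"
  shows "minor A (Suc n) r c = A (r 0) (c 0) * minor A n (r \<circ> Suc) (c \<circ> Suc)"
proof -
  let ?M = "mat (Suc n) (Suc n) (\<lambda>(i, j). A (r i) (c j))"
  have "minor A (Suc n) r c = (\<Sum>j<Suc n. ?M $$ (0, j) * cofactor ?M 0 j)"
    unfolding minor_def by (rule laplace_expansion_row) auto
  also have "\<dots> = ?M $$ (0, 0) * cofactor ?M 0 0"
    by (subst sum.remove[where x = 0]) (auto intro!: sum.neutral simp: assms)
  also have "mat_delete ?M 0 0 = mat n n (\<lambda>(i, j). A (r (Suc i)) (c (Suc j)))"
    by (intro eq_matI) (auto simp: mat_delete_def)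
  then have "cofactor ?M 0 0 = minor A n (r \<circ> Suc) (c \<circ> Suc)"
    by (simp add: cofactor_def minor_def)
  finally show ?thesis
    by simp
qed

text \<open>Increasing indices can take the value 0 only at position 0. So a minor avoids row and
  column 0 and is a minor of \<open>A\<close>, or contains both and loses them by expansion, or
  contains exactly one and vanishes. Shifting the rows down turns the bound \<open>Suc N\<close>
  into \<open>N\<close>.\<close>

lemma minor_one_block_sum_nonneg:
  assumes A: "\<And>n r c. strict_mono_on {..<n} r \<Longrightarrow> strict_mono_on {..<n} c
      \<Longrightarrow> r \<in> {..<n} \<rightarrow> {..<N} \<Longrightarrow> 0 \<le> minor A n r c"
    and r: "strict_mono_on {..<n} r" and c: "strict_mono_on {..<n} c"
    and rN: "r \<in> {..<n} \<rightarrow> {..<Suc N}"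
  shows "0 \<le> minor (one_block_sum A) n r c"
proof -
  \<comment> \<open>Generalised over the indices, since it is applied to the whole minor and also to
    the one left after deleting the first row and column.\<close>
  have positive: "0 \<le> minor (one_block_sum A) n r c"
    if r: "strict_mono_on {..<n} r" and c: "strict_mono_on {..<n} c"
      and rN: "r \<in> {..<n} \<rightarrow> {..<Suc N}"
      and r0: "\<And>i. i < n \<Longrightarrow> 0 < r i" and c0: "\<And>j. j < n \<Longrightarrow> 0 < c j" for n r c
  proof -
    have "minor (one_block_sum A) n r c
        = minor (one_block_sum A) n (\<lambda>i. Suc (r i - 1)) (\<lambda>j. Suc (c j - 1))"
      by (rule minor_cong) (use r0 c0 in auto)
    also have "\<dots> = minor A n (\<lambda>i. r i - 1) (\<lambda>j. c j - 1)"
      by (rule minor_one_block_sum_Suc)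
    also have "\<dots> \<ge> 0"
    proof (rule A)
      show "strict_mono_on {..<n} (\<lambda>i. r i - 1)" "strict_mono_on {..<n} (\<lambda>j. c j - 1)"
        using r c r0 c0 by (auto simp: strict_mono_on_def Suc_le_eq intro!: diff_less_mono)
      show "(\<lambda>i. r i - 1) \<in> {..<n} \<rightarrow> {..<N}"
      proof (rule Pi_I)
        fix i assume "i \<in> {..<n}"
        then show "r i - 1 \<in> {..<N}"
          using funcset_mem[OF rN, of i] r0[of i] by simp
      qed
    qed
    finally show ?thesis .
  qed
  show ?thesis
  proof (cases n)
    case 0
    then show ?thesis
      by (simp add: minor_def)
  next
    case (Suc m)
    have rpos: "0 < r j" and cpos: "0 < c j" if "0 < j" "j < n" for j
      using strict_mono_onD[OF r, of 0 j] strict_mono_onD[OF c, of 0 j] that by auto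
    consider "r 0 = 0" "c 0 = 0" | "r 0 = 0" "0 < c 0" | "0 < r 0" "c 0 = 0" | "0 < r 0" "0 < c 0"
      by blast
    then show ?thesis
    proof cases
      case 1
      have "minor (one_block_sum A) n r c
          = one_block_sum A (r 0) (c 0) * minor (one_block_sum A) m (r \<circ> Suc) (c \<circ> Suc)"
        unfolding Suc by (rule minor_Suc_first_row) (use 1 cpos Suc in \<open>auto simp: one_block_sum_def\<close>)
      moreover have "0 \<le> minor (one_block_sum A) m (r \<circ> Suc) (c \<circ> Suc)"
      proof (rule positive)
        show "strict_mono_on {..<m} (r \<circ> Suc)" "strict_mono_on {..<m} (c \<circ> Suc)"
          using r c unfolding Suc by (simp_all add: strict_mono_on_def)
        show "r \<circ> Suc \<in> {..<m} \<rightarrow> {..<Suc N}"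
          using rN unfolding Suc by (simp add: Pi_iff)
        show "0 < (r \<circ> Suc) i" "0 < (c \<circ> Suc) i" if "i < m" for i
          using that rpos[of "Suc i"] cpos[of "Suc i"] Suc by simp_all
      qed
      ultimately show ?thesis
        using 1 by (simp add: one_block_sum_def)
    next
      \<comment> \<open>Row 0 is selected without column 0, so its selected entries are all
        0.\<close>
      case 2
      then have "minor (one_block_sum A) n r c
          = one_block_sum A (r 0) (c 0) * minor (one_block_sum A) m (r \<circ> Suc) (c \<circ> Suc)"
        unfolding Suc using cpos Suc
        by (intro minor_Suc_first_row) (auto simp: one_block_sum_def)
      then show ?thesis
        using 2 by (simp add: one_block_sum_def)
    next
      \<comment> \<open>Column 0 is selected without row 0, so the first column of the minor is
        zero.\<close>
      case 3
      let ?M = "mat n n (\<lambda>(i, j). one_block_sum A (r i) (c j))"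
      have "0 < r i" if "i < n" for i
        using 3 rpos[of i] that by (cases "i = 0") auto
      then have "?M $$ (i, 0) = 0" if "i < n" for i
        using 3 that Suc by (simp add: one_block_sum_def)
      moreover have "det ?M = (\<Sum>i<n. ?M $$ (i, 0) * cofactor ?M i 0)"
        by (rule laplace_expansion_column) (use Suc in auto)
      ultimately show ?thesis
        by (simp add: minor_def)
    next
      case 4
      have "0 < r i" "0 < c i" if "i < n" for i
        using 4 rpos[of i] cpos[of i] that by (cases "i = 0"; auto)+
      then show ?thesis
        using r c rN by (intro positive) auto
    qed
  qed
qed

section \<open>Factorisation of the array\<close>

text \<open>Past the initial column 1, the columns start at \<open>f1\<close> and are multiplied
  alternately by \<open>f2\<close> and \<open>f1\<close>, so the two multipliers swap roles.\<close>

lemma riordan_column_1_Suc: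
  "riordan_column 1 f1 f2 (Suc k) = riordan_column f1 f2 f1 k"
  by (auto simp: riordan_column_def mult_ac elim!: oddE)

lemma riordan_column_scale: "riordan_column (a * g) f1 f2 k = a * riordan_column g f1 f2 k"
  by (simp add: riordan_column_def mult_ac)

text \<open>All columns but the first contain the factor \<open>f1\<close>; its \<open>fps_X\<close>
  moves them down one row, which leaves the corner entry 1 as a separate block.\<close>

lemma compressed_double_riordan_1:
  assumes "f1 = fps_X * h"
  shows "compressed_double_riordan 1 f1 f2 = one_block_sum (compressed_double_riordan h f2 f1)"
proof (intro ext)
  fix i j
  show "compressed_double_riordan 1 f1 f2 i j = one_block_sum (compressed_double_riordan h f2 f1) i j"
  proof (cases j)
    case 0
    then show ?thesis
      by (simp add: compressed_double_riordan_def one_block_sum_def riordan_column_def)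
  next
    case (Suc k)
    have "riordan_column 1 f1 f2 j = fps_X * riordan_column h f2 f1 k"
      unfolding Suc riordan_column_1_Suc by (subst assms) (rule riordan_column_scale)
    then show ?thesis
      using Suc by (simp add: compressed_double_riordan_def one_block_sum_def)
  qed
qed

lemma compressed_double_riordan_factor:
  assumes "i < N"
  shows "compressed_double_riordan g f1 f2 i j
    = (\<Sum>k<N. toeplitz (fps_nth g) i k * compressed_double_riordan 1 f1 f2 k j)"
proof -
  \<comment> \<open>With \<open>g\<close> as the right factor, the convolution takes its coefficient
    at \<open>i - k\<close>, the Toeplitz entry.\<close>
  have "compressed_double_riordan g f1 f2 i j = fps_nth (riordan_column 1 f1 f2 j * g) i"
    using riordan_column_scale[of g 1 f1 f2 j] by (simp add: compressed_double_riordan_def mult.commute)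
  also have "\<dots> = (\<Sum>k\<le>i. toeplitz (fps_nth g) i k * compressed_double_riordan 1 f1 f2 k j)"
    unfolding fps_mult_nth atLeast0AtMost
    by (rule sum.cong) (auto simp: compressed_double_riordan_def toeplitz_def)
  \<comment> \<open>Entries with \<open>k > i\<close> lie above the diagonal and vanish, so one
    range serves all rows below \<open>N\<close>.\<close>
  also have "\<dots> = (\<Sum>k<N. toeplitz (fps_nth g) i k * compressed_double_riordan 1 f1 f2 k j)"
    by (rule sum.mono_neutral_left) (use assms in \<open>auto simp: toeplitz_def\<close>)
  finally show ?thesis .
qed

section \<open>Polya frequency series and the induction\<close>

lemma PF_fps_divide_X:
  assumes "PF_fps (fps_X * h)"
  shows "PF_fps h"
proof -
  have "0 \<le> fps_nth h n" for n
    using assms[unfolded PF_fps_def PF_sequence_def, THEN conjunct1, rule_format, of "Suc n"] by simp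
  \<comment> \<open>At \<open>j = Suc i\<close> both sides are 0, because \<open>fps_X * h\<close>
    has constant coefficient 0.\<close>
  moreover have T: "toeplitz (fps_nth h) i j = toeplitz (fps_nth (fps_X * h)) (Suc i) j" for i j
    by (auto simp: toeplitz_def Suc_diff_le)
  have "totally_positive (toeplitz (fps_nth h))"
    unfolding totally_positive_def
  proof (intro allI impI)
    fix n and r c :: "nat \<Rightarrow> nat"
    assume "strict_mono_on {..<n} r" "strict_mono_on {..<n} c"
    then have "0 \<le> minor (toeplitz (fps_nth (fps_X * h))) n (\<lambda>i. Suc (r i)) c"
      using assms unfolding PF_fps_def PF_sequence_def totally_positive_def
      by (simp add: strict_mono_on_def)
    then show "0 \<le> minor (toeplitz (fps_nth h)) n r c"
      by (simp add: minor_def T)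
  qed
  ultimately show ?thesis
    by (simp add: PF_fps_def PF_sequence_def)
qed

text \<open>Induction on the row bound \<open>N\<close>. The series must stay arbitrary, because the
  step passes from \<open>(g; f1, f2)\<close> to \<open>(h; f2, f1)\<close>.\<close>

lemma minor_compressed_double_riordan_nonneg:
  assumes "PF_fps g" "PF_fps f1" "PF_fps f2" "fps_nth f1 0 = 0" "fps_nth f2 0 = 0"
    and "strict_mono_on {..<n} r" "strict_mono_on {..<n} c" "r \<in> {..<n} \<rightarrow> {..<N}"
  shows "0 \<le> minor (compressed_double_riordan g f1 f2) n r c"
  using assms
proof (induction N arbitrary: g f1 f2 n r c)
  case 0
  then have "n = 0"
    by auto
  then show ?case
    by (simp add: minor_def)
next
  case (Suc N)
  define h where "h = fps_shift 1 f1"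
  have f1: "f1 = fps_X * h"
    using Suc.prems(4) by (intro fps_ext) (simp add: h_def)
  have h: "PF_fps h"
    using Suc.prems(2) PF_fps_divide_X unfolding f1 by blast
  show ?case
  proof (rule minor_product_nonneg)
    show "compressed_double_riordan g f1 f2 (r i) (c j)
        = (\<Sum>k<Suc N. toeplitz (fps_nth g) (r i) k * compressed_double_riordan 1 f1 f2 k (c j))"
      if "i < n" for i j
      using that Suc.prems(8) by (intro compressed_double_riordan_factor) auto
    show "0 \<le> minor (toeplitz (fps_nth g)) n r s" if "strict_mono_on {..<n} s" for s
      using that Suc.prems(1,6) by (simp add: PF_fps_def PF_sequence_def totally_positive_def)
    show "0 \<le> minor (compressed_double_riordan 1 f1 f2) n s c"
      if "strict_mono_on {..<n} s" "s \<in> {..<n} \<rightarrow> {..<Suc N}" for s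
      unfolding compressed_double_riordan_1[OF f1]
      \<comment> \<open>The premises on \<open>f1\<close> and \<open>f2\<close> are handed over in
        swapped order.\<close>
      by (rule minor_one_block_sum_nonneg[OF Suc.IH[OF h Suc.prems(3,2,5,4)]])
        (use that Suc.prems(7) in auto)
  qed
qed

theorem theorem5p1:
  fixes g f1 f2 :: "real fps"
  assumes "fps_nth g 0 \<noteq> 0"
    and "subdegree f1 = 1"
    and "subdegree f2 = 1"
    and "PF_fps g"
    and "PF_fps f1"
    and "PF_fps f2"
  shows "totally_positive (compressed_double_riordan g f1 f2)"
  unfolding totally_positive_def
proof (intro allI impI)
  fix n and r c :: "nat \<Rightarrow> nat"
  assume rc: "strict_mono_on {..<n} r" "strict_mono_on {..<n} c"
  have "fps_nth f1 0 = 0" "fps_nth f2 0 = 0"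
    by (rule nth_less_subdegree_zero; simp add: assms(2,3))+
  \<comment> \<open>A minor uses finitely many rows, so some bound exists. For \<open>n = 0\<close>
    the value of \<open>Max\<close> is irrelevant, as there is no row to bound.\<close>
  moreover have "r \<in> {..<n} \<rightarrow> {..<Suc (Max (r ` {..<n}))}"
    by (rule Pi_I) (simp add: less_Suc_eq_le)
  ultimately show "0 \<le> minor (compressed_double_riordan g f1 f2) n r c"
    by (rule minor_compressed_double_riordan_nonneg[OF assms(4-6) _ _ rc])
qed

end
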